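(* Let $K$ be a finite simplicial complex with vertex set $V$, $|V|=n$, and let $f\colon V\to\{1,\dots,n\}$ be an order function (a bijection), extended to $K$ by $f(\sigma)=\max\{f(v)\mid v\in\sigma\}$, with appearance function $\omega(\sigma)=\min\{f(v)\mid v\in\sigma\}$. Let $F_f$ be the colex vector field induced by $f$ and suppose $\{\alpha\to\beta\}\in F_f$, where $\beta=\{c_f(\alpha)\}\cup\alpha$. Then: (a) $f(c_f(\alpha))<f(v)$ for every vertex $v\in\alpha$, or equivalently, $c_f(\alpha)<^{\mathrm{co}}v$. (b) $f(c_f(\alpha))<\omega(\alpha)$. (c) $f(\alpha)=f(\beta)$. (d) $\alpha$ is the unique codimension-1 face of $\beta$ such that $\omega(\alpha)>\omega(\beta)$. (e) $\alpha<^{\mathrm{co}}\beta$ are adjacent in colex order: there exists no $\gamma\in K$ such that $\alpha<^{\mathrm{co}}\gamma<^{\mathrm{co}}\beta$. (f) In the simplex-wise lower star filtration given by the colex order induced by $f$, the persistent homology contains the pair $(\alpha,\beta)$.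
   Context: Simplices are nonempty finite subsets of $V$; $K$ is closed under taking nonempty subsets. A codimension-1 face of $\beta$ is a subset of $\beta$ with exactly one vertex fewer. Candidate list and candidate vertex: for $\sigma\in K$, $V_\sigma=\{v\in V\mid \{v\}\cup\sigma\in K\}$ and $c_f(\sigma)=\operatorname{argmin}_{v\in V_\sigma}f(v)$. Colex vector field: $F_f$ is the collection of pairs (arrows) $\{\alpha\to\beta\}$ of simplices of $K$ of dimensions $p$ and $p+1$ (any $p\ge 0$) such that $\beta=\{c_f(\alpha)\}\cup\alpha$ and $c_f(\alpha)\notin\alpha$. Colex order: order $V$ by $f$, and view each simplex as the word of its vertices listed in increasing order of $f$. For distinct words $a=a_0\cdots a_k$ and $b=b_0\cdots b_\ell$, compare from the end: let $J$ be the smallest $i\in\{0,\dots,\min\{k,\ell\}\}$ with $a_{k-i}\ne b_{\ell-i}$. If $J$ exists, $a<^{\mathrm{co}}b$ iff $a_{k-J}<b_{\ell-J}$; if no such $i$ exists, $a<^{\mathrm{co}}b$ iff $k<\ell$. A vertex is identified with a one-letter word. Simplex-wise lower star filtration: list all simplices of $K$ in colex order as $\sigma_1,\dots,\sigma_N$ and set $K^i=\{\sigma_j\mid j\le i\}$, $0\le i\le N$. Homology is over $\mathbb{Z}/2\mathbb{Z}$. Persistence pair: let $D$ be the $N\times N$ boundary matrix over $\mathbb{Z}/2\mathbb{Z}$ with $D[i,j]=1$ iff $\sigma_i$ is a codimension-1 face of $\sigma_j$. Write $D=RU$ with $U$ invertible upper triangular and $R$ reduced (the lowest $1$'s of distinct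 nonzero columns lie in distinct rows). Then $(\sigma_i,\sigma_j)$ is a (birth-death) pair of the persistent homology if the lowest $1$ in column $j$ of $R$ is in row $i$; this does not depend on the choice of decomposition. *)

theory Defs
  imports "HOL-Library.Z2" "Jordan_Normal_Form.Matrix"
begin

text \<open>The empty set is not a simplex. Elements of \<open>V\<close> are not required to span a simplex of \<open>K\<close>.\<close>

definition simplicial_complex :: "'a set \<Rightarrow> 'a set set \<Rightarrow> bool" where
  "simplicial_complex V K \<longleftrightarrow>
     (\<forall>\<sigma>\<in>K. \<sigma> \<noteq> {} \<and> finite \<sigma> \<and> \<sigma> \<subseteq> V) \<and>
     (\<forall>\<sigma>\<in>K. \<forall>\<tau>. \<tau> \<noteq> {} \<and> \<tau> \<subseteq> \<sigma> \<longrightarrow> \<tau> \<in> K)"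

definition sdim :: "'a set \<Rightarrow> nat" where
  "sdim \<sigma> = card \<sigma> - 1"

definition codim1_face :: "'a set \<Rightarrow> 'a set \<Rightarrow> bool" where
  "codim1_face \<tau> \<beta> \<longleftrightarrow> \<tau> \<subseteq> \<beta> \<and> card \<beta> = card \<tau> + 1"

definition simplex_value :: "('a \<Rightarrow> nat) \<Rightarrow> 'a set \<Rightarrow> nat" where
  "simplex_value f \<sigma> = Max (f ` \<sigma>)"

definition appearance :: "('a \<Rightarrow> nat) \<Rightarrow> 'a set \<Rightarrow> nat" where
  "appearance f \<sigma> = Min (f ` \<sigma>)"

definition candidate_list :: "'a set \<Rightarrow> 'a set set \<Rightarrow> 'a set \<Rightarrow> 'a set" where
  "candidate_list V K \<sigma> = {v \<in> V. {v} \<union> \<sigma> \<in> K}"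

definition candidate_vertex :: "'a set \<Rightarrow> 'a set set \<Rightarrow> ('a \<Rightarrow> nat) \<Rightarrow> 'a set \<Rightarrow> 'a" where
  "candidate_vertex V K f \<sigma> = arg_min_on f (candidate_list V K \<sigma>)"

definition colex_vector_field ::
    "'a set \<Rightarrow> 'a set set \<Rightarrow> ('a \<Rightarrow> nat) \<Rightarrow> ('a set \<times> 'a set) set" where
  "colex_vector_field V K f =
     {(\<alpha>, \<beta>). \<alpha> \<in> K \<and> \<beta> \<in> K \<and> sdim \<beta> = sdim \<alpha> + 1 \<and>
        \<beta> = {candidate_vertex V K f \<alpha>} \<union> \<alpha> \<and> candidate_vertex V K f \<alpha> \<notin> \<alpha>}"

definition vertex_word :: "('a \<Rightarrow> nat) \<Rightarrow> 'a set \<Rightarrow> 'a list" where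
  "vertex_word f \<sigma> = sorted_key_list_of_set f \<sigma>"

text \<open>Words are compared from the end, so the comparison runs over the reversed lists; letters are
  compared by their \<open>f\<close>-values. For equal words this gives \<open>False\<close>.\<close>

definition word_colex_less :: "('a \<Rightarrow> nat) \<Rightarrow> 'a list \<Rightarrow> 'a list \<Rightarrow> bool" where
  "word_colex_less f a b \<longleftrightarrow>
     (let differ = (\<lambda>i. i < min (length a) (length b) \<and> rev a ! i \<noteq> rev b ! i)
      in if \<exists>i. differ i
         then f (rev a ! (LEAST i. differ i)) < f (rev b ! (LEAST i. differ i))
         else length a < length b)"

definition colex_less :: "('a \<Rightarrow> nat) \<Rightarrow> 'a set \<Rightarrow> 'a set \<Rightarrow> bool" where
  "colex_less f \<sigma> \<tau> \<longleftrightarrow> word_colex_less f (vertex_word f \<sigma>) (vertex_word f \<tau>)"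

text \<open>The simplex-wise lower star filtration is encoded by the list of all simplices in colex
  order: its \<open>i\<close>-th complex is the set of the first \<open>i\<close> entries. If \<open>K\<close> is a finite complex on \<open>V\<close>
  and \<open>f\<close> is injective on \<open>V\<close>, there is exactly one such list.\<close>

definition colex_filtration :: "('a \<Rightarrow> nat) \<Rightarrow> 'a set set \<Rightarrow> 'a set list" where
  "colex_filtration f K =
     (THE \<sigma>s. distinct \<sigma>s \<and> set \<sigma>s = K \<and> sorted_wrt (colex_less f) \<sigma>s)"

text \<open>Matrix and list indices start at 0.\<close>

definition boundary_matrix :: "'a set list \<Rightarrow> bit mat" where
  "boundary_matrix \<sigma>s = mat (length \<sigma>s) (length \<sigma>s)
     (\<lambda>(i, j). if codim1_face (\<sigma>s ! i) (\<sigma>s ! j) then 1 else 0)"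

definition is_lowest_one :: "bit mat \<Rightarrow> nat \<Rightarrow> nat \<Rightarrow> bool" where
  "is_lowest_one R i j \<longleftrightarrow> i < dim_row R \<and> j < dim_col R \<and> R $$ (i, j) = 1 \<and>
     (\<forall>i'. i < i' \<and> i' < dim_row R \<longrightarrow> R $$ (i', j) = 0)"

definition reduced_matrix :: "bit mat \<Rightarrow> bool" where
  "reduced_matrix R \<longleftrightarrow>
     (\<forall>i i' j j'. is_lowest_one R i j \<and> is_lowest_one R i' j' \<and> j \<noteq> j' \<longrightarrow> i \<noteq> i')"

definition RU_decomposition :: "bit mat \<Rightarrow> bit mat \<Rightarrow> bit mat \<Rightarrow> bool" where
  "RU_decomposition D R U \<longleftrightarrow>
     R \<in> carrier_mat (dim_row D) (dim_col D) \<and> U \<in> carrier_mat (dim_col D) (dim_col D) \<and>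
     D = R * U \<and> invertible_mat U \<and> upper_triangular U \<and> reduced_matrix R"

text \<open>The choice of decomposition does not matter: the positions of the lowest ones of \<open>R\<close> are
  determined by \<open>D\<close>.\<close>

definition persistence_pairs :: "'a set list \<Rightarrow> ('a set \<times> 'a set) set" where
  "persistence_pairs \<sigma>s =
     {(\<sigma>s ! i, \<sigma>s ! j) | i j.
        \<exists>R U. RU_decomposition (boundary_matrix \<sigma>s) R U \<and> is_lowest_one R i j}"

end

theory Submission
  imports Defs "HOL-Library.Nat_Bijection" "Jordan_Normal_Form.Determinant"
begin

text \<open>Reading \<open>f ` \<sigma>\<close> as a set of binary digits turns the colex order into the order of natural
  numbers. If \<open>\<beta> = {c} \<union> \<alpha>\<close> with \<open>f c\<close> below all values on \<open>\<alpha>\<close>, the code of \<open>\<beta>\<close> is that of \<open>\<alpha>\<close> plus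
  \<open>2 ^ f c\<close>, so every code in between belongs to \<open>\<alpha>\<close> together with vertices of value below \<open>f c\<close>;
  such a vertex would contradict the minimality of \<open>c\<close>. Hence \<open>\<alpha>\<close> and \<open>\<beta>\<close> are neighbours in the
  filtration, at positions \<open>j - 1\<close> and \<open>j\<close>. Since the boundary matrix is strictly upper triangular,
  earlier columns vanish in all rows from \<open>j - 1\<close> on, and no column reduction can remove
  the entry \<open>1\<close> at \<open>(j - 1, j)\<close>.\<close>

section \<open>Column reduction\<close>

text \<open>Downward induction on the row \<open>i\<close>: in the entry \<open>(i, j)\<close> of
  \<open>A * B\<close> with \<open>j < i\<close>, the terms with \<open>k < i\<close> vanish since
  \<open>A\<close> is triangular and those with \<open>k > i\<close> by induction, leaving
  \<open>A $$ (i, i) * B $$ (i, j) = 0\<close>.\<close>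

lemma upper_triangular_right_inverse:
  fixes A B :: "'a::idom mat"
  assumes A: "A \<in> carrier_mat m m" and B: "B \<in> carrier_mat m m"
    and ut: "upper_triangular A" and diag: "\<And>i. i < m \<Longrightarrow> A $$ (i, i) \<noteq> 0"
    and AB: "A * B = 1\<^sub>m m"
  shows "upper_triangular B"
proof -
  have zero: "j < i \<Longrightarrow> B $$ (i, j) = 0" if "i < m" for i j
    using that
  proof (induction "m - i" arbitrary: i rule: less_induct)
    case less
    have "0 = (A * B) $$ (i, j)"
      using less.prems AB by simp
    also have "\<dots> = (\<Sum>k\<in>{0..<m}. A $$ (i, k) * B $$ (k, j))"
      using A B less.prems by (auto simp: scalar_prod_def)
    also have "\<dots> = (\<Sum>k\<in>{i}. A $$ (i, k) * B $$ (k, j))"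
    proof (rule sum.mono_neutral_right)
      show "\<forall>k\<in>{0..<m} - {i}. A $$ (i, k) * B $$ (k, j) = 0"
      proof
        fix k assume k: "k \<in> {0..<m} - {i}"
        show "A $$ (i, k) * B $$ (k, j) = 0"
        proof (cases "k < i")
          case True
          then show ?thesis using ut A less.prems by auto
        next
          case False
          then have "B $$ (k, j) = 0"
            using less.prems k by (intro less.hyps diff_less_mono2) auto
          then show ?thesis by simp
        qed
      qed
    qed (use less.prems in auto)
    finally show ?case
      using diag less.prems by auto
  qed
  show ?thesis
    using zero B by auto
qed

lemma ex_column_reduction:
  fixes D :: "bit mat"
  assumes D: "D \<in> carrier_mat n m"
  obtains W where "W \<in> carrier_mat m m" "upper_triangular W" "\<And>j. j < m \<Longrightarrow> W $$ (j, j) = 1"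
    "reduced_matrix (D * W)"
proof -
  define comb where "comb c i = (\<Sum>k\<in>{0..<m}. D $$ (i, k) * c k)" for c i
  \<comment> \<open>One more than the index of the lowest nonzero entry of the combined column, and
    \<open>0\<close> for a zero column.\<close>
  define low where "low c = (LEAST l. \<forall>i<n. l \<le> i \<longrightarrow> comb c i = 0)" for c
  define adm where "adm j c \<longleftrightarrow> c j = 1 \<and> (\<forall>k>j. c k = 0)" for j :: nat and c :: "nat \<Rightarrow> bit"
  \<comment> \<open>Each column is replaced by a combination of it with earlier ones whose lowest one is as high as
    possible; two such columns with equal lowest ones could be added to contradict this.\<close>
  define C where "C j = arg_min low (adm j)" for j
  define W where "W = mat m m (\<lambda>(k, j). C j k)"
  have "adm j (\<lambda>k. if k = j then 1 else 0)" for j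
    by (simp add: adm_def)
  then have adm_C: "adm j (C j)" for j
    unfolding C_def by (rule arg_min_natI[of "adm j" _ low for j])
  have low_C: "low (C j) \<le> low c" if "adm j c" for j c
    unfolding C_def using that by (rule arg_min_nat_le[of "adm j" _ low])
  have DW: "(D * W) $$ (i, j) = comb (C j) i" if "i < n" "j < m" for i j
    using that D by (auto simp: W_def comb_def scalar_prod_def)
  have dims: "dim_row (D * W) = n" "dim_col (D * W) = m"
    using D by (auto simp: W_def)
  have low_eq: "low (C j) = Suc i" if "is_lowest_one (D * W) i j" for i j
    unfolding low_def
  proof (rule Least_equality)
    show "\<forall>i'<n. Suc i \<le> i' \<longrightarrow> comb (C j) i' = 0"
      using that DW dims by (auto simp: is_lowest_one_def Suc_le_eq)
  next
    fix l assume l: "\<forall>i<n. l \<le> i \<longrightarrow> comb (C j) i = 0"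
    show "Suc i \<le> l"
    proof (rule ccontr)
      assume "\<not> Suc i \<le> l"
      then have "comb (C j) i = 0" using l that dims by (auto simp: is_lowest_one_def)
      then show False using that DW dims by (auto simp: is_lowest_one_def)
    qed
  qed
  have no_clash: False
    if l: "is_lowest_one (D * W) i j" "is_lowest_one (D * W) i j'" "j < j'" for i j j'
  proof -
    \<comment> \<open>Adding the earlier column keeps \<open>c\<close> admissible for
      \<open>j'\<close>, since \<open>C j\<close> vanishes from \<open>j'\<close> on. The sum is
      zero from row \<open>i\<close> on: both columns have a \<open>1\<close> in row
      \<open>i\<close> and zeros below, and \<open>1 + 1 = 0\<close>.\<close>
    define c where "c k = C j' k + C j k" for k
    have "adm j' c"
      using adm_C[of j] adm_C[of j'] \<open>j < j'\<close> by (simp add: adm_def c_def)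
    then have "Suc i \<le> low c"
      using low_C low_eq l by metis
    have comb_c: "comb c i' = comb (C j') i' + comb (C j) i'" for i'
      by (simp only: comb_def c_def distrib_left sum.distrib)
    have "\<forall>i'<n. i \<le> i' \<longrightarrow> comb c i' = 0"
    proof (intro allI impI)
      fix i' assume "i' < n" "i \<le> i'"
      then have "comb (C j') i' = comb (C j) i'"
        using l DW dims unfolding is_lowest_one_def by (metis le_neq_implies_less)
      then show "comb c i' = 0" by (simp add: comb_c)
    qed
    then have "low c \<le> i"
      unfolding low_def by (rule Least_le)
    with \<open>Suc i \<le> low c\<close> show False by simp
  qed
  show thesis
  proof (rule that)
    show "W \<in> carrier_mat m m" by (simp add: W_def)
    show "upper_triangular W" using adm_C by (auto simp: W_def adm_def)
    show "W $$ (j, j) = 1" if "j < m" for j using that adm_C by (simp add: W_def adm_def)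
    show "reduced_matrix (D * W)"
      unfolding reduced_matrix_def using no_clash by (metis nat_neq_iff)
  qed
qed

text \<open>The reducing matrix \<open>W\<close> has no zero on its diagonal, hence an inverse
  \<open>U\<close>, and \<open>D = D * W * U\<close>. \<open>W\<close> is returned too, since the
  entries of \<open>R = D * W\<close> are later computed from it.\<close>

lemma ex_RU_decomposition:
  fixes D :: "bit mat"
  assumes D: "D \<in> carrier_mat n m"
  obtains W U where "W \<in> carrier_mat m m" "upper_triangular W" "\<And>j. j < m \<Longrightarrow> W $$ (j, j) = 1"
    "RU_decomposition D (D * W) U"
proof -
  obtain W where W: "W \<in> carrier_mat m m" "upper_triangular W" "\<And>j. j < m \<Longrightarrow> W $$ (j, j) = 1"
    "reduced_matrix (D * W)"
    using ex_column_reduction[OF D] by metis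
  have "0 \<notin> set (diag_mat W)"
    using W by (auto simp: diag_mat_def)
  then have "det W \<noteq> 0"
    using upper_triangular_imp_det_eq_0_iff[OF W(1,2)] by simp
  then have "W \<in> Units (ring_mat TYPE(bit) m ())"
    by (rule det_non_zero_imp_unit[OF W(1)])
  then obtain U where U: "U \<in> carrier_mat m m" "W * U = 1\<^sub>m m" "U * W = 1\<^sub>m m"
    by (auto simp: Units_def ring_mat_def)
  have "upper_triangular U"
    using upper_triangular_right_inverse[OF W(1) U(1) W(2) _ U(2)] W(3) by simp
  moreover have "D = D * W * U"
    using D W U by (simp add: assoc_mult_mat[of D n m W m U m])
  moreover have "invertible_mat U"
    using U W unfolding invertible_mat_def inverts_mat_def by (intro conjI exI[of _ W]) auto
  ultimately have "RU_decomposition D (D * W) U"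
    using D W U by (auto simp: RU_decomposition_def)
  with W show thesis using that by blast
qed

text \<open>\<open>persistence_pairs\<close> asks for some decomposition only, so it is enough to
  find the lowest one in column \<open>Suc j\<close> for the decomposition constructed
  above.\<close>

lemma consecutive_persistence_pair:
  assumes j: "Suc j < length \<sigma>s" and face: "codim1_face (\<sigma>s ! j) (\<sigma>s ! Suc j)"
    and order: "\<And>i k. i < length \<sigma>s \<Longrightarrow> k < length \<sigma>s \<Longrightarrow> codim1_face (\<sigma>s ! i) (\<sigma>s ! k) \<Longrightarrow> i < k"
  shows "(\<sigma>s ! j, \<sigma>s ! Suc j) \<in> persistence_pairs \<sigma>s"
proof -
  let ?D = "boundary_matrix \<sigma>s" and ?N = "length \<sigma>s"
  have D: "?D \<in> carrier_mat ?N ?N" by (simp add: boundary_matrix_def)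
  obtain W U where W: "W \<in> carrier_mat ?N ?N" "upper_triangular W"
      "\<And>j. j < ?N \<Longrightarrow> W $$ (j, j) = 1"
    and RU: "RU_decomposition ?D (?D * W) U"
    using ex_RU_decomposition[OF D] by blast
  have D0: "?D $$ (i, k) = 0" if "k \<le> i" "i < ?N" for i k
    using order[of i k] that by (auto simp: boundary_matrix_def)
  have prod: "(?D * W) $$ (i, Suc j) = (\<Sum>k\<in>{0..<?N}. ?D $$ (i, k) * W $$ (k, Suc j))"
    if "i < ?N" for i
    using that j D W by (auto simp: scalar_prod_def)
  have W0: "W $$ (k, Suc j) = 0" if "Suc j < k" "k < ?N" for k
    using W that by auto
  have "(?D * W) $$ (j, Suc j) = (\<Sum>k\<in>{0..<?N}. ?D $$ (j, k) * W $$ (k, Suc j))"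
    using prod j by simp
  \<comment> \<open>For \<open>k <= j\<close> the factor from \<open>?D\<close> is zero, because
    faces come strictly before cofaces; for \<open>k > Suc j\<close> the factor from
    \<open>W\<close> is zero.\<close>
  also have "\<dots> = (\<Sum>k\<in>{Suc j}. ?D $$ (j, k) * W $$ (k, Suc j))"
  proof (rule sum.mono_neutral_right)
    show "\<forall>k\<in>{0..<?N} - {Suc j}. ?D $$ (j, k) * W $$ (k, Suc j) = 0"
    proof
      fix k assume k: "k \<in> {0..<?N} - {Suc j}"
      then consider "k \<le> j" | "Suc j < k" by force
      then show "?D $$ (j, k) * W $$ (k, Suc j) = 0"
        using D0[of k j] W0[of k] k j by cases auto
    qed
  qed (use j in auto)
  also have "\<dots> = 1"
    using j face W by (simp add: boundary_matrix_def)
  finally have one: "(?D * W) $$ (j, Suc j) = 1" .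
  \<comment> \<open>In a row \<open>i > j\<close> the two ranges of zeros, \<open>k <= i\<close> for
    \<open>?D\<close> and \<open>k > Suc j\<close> for \<open>W\<close>, cover all
    \<open>k\<close>.\<close>
  have zero: "(?D * W) $$ (i, Suc j) = 0" if "j < i" "i < ?N" for i
  proof -
    have "?D $$ (i, k) * W $$ (k, Suc j) = 0" if "k < ?N" for k
      using D0[of k i] W0[of k] \<open>j < i\<close> \<open>i < ?N\<close> that by (cases "k \<le> i") auto
    then show ?thesis unfolding prod[OF \<open>i < ?N\<close>] by (intro sum.neutral) auto
  qed
  have "is_lowest_one (?D * W) j (Suc j)"
    using one zero j D W by (auto simp: is_lowest_one_def)
  with RU show ?thesis unfolding persistence_pairs_def by blast
qed

section \<open>The colex order as an order of binary numbers\<close>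

text \<open>Equal last letters shift the least differing index of the reversed words by one, and
  different ones put it at \<open>0\<close>. This recursion replaces the \<open>LEAST\<close> of the
  definition and suits induction from the end of a word.\<close>

lemma word_colex_less_snoc:
  "word_colex_less f (xs @ [x]) (ys @ [y]) \<longleftrightarrow>
     (if x = y then word_colex_less f xs ys else f x < f y)"
proof (cases "x = y")
  case True
  define P where "P i \<longleftrightarrow> i < min (length xs) (length ys) \<and> rev xs ! i \<noteq> rev ys ! i" for i
  define Q where "Q i \<longleftrightarrow> i < min (length (xs @ [x])) (length (ys @ [y])) \<and>
    rev (xs @ [x]) ! i \<noteq> rev (ys @ [y]) ! i" for i
  have Q: "\<not> Q 0" "Q (Suc i) = P i" for i
    using True by (auto simp: P_def Q_def)
  have ex: "(\<exists>i. Q i) \<longleftrightarrow> (\<exists>i. P i)"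
    using Q by (metis not0_implies_Suc)
  have least: "(LEAST i. Q i) = Suc (LEAST i. P i)" if "\<exists>i. P i"
    using that Q Least_Suc[of Q] by auto
  show ?thesis
    using True ex least
    unfolding word_colex_less_def Let_def P_def[symmetric] Q_def[symmetric] by auto
next
  case False
  then show ?thesis
    by (auto simp: word_colex_less_def Let_def Least_equality intro!: exI[of _ 0])
qed

lemma word_colex_less_Nil: "\<not> word_colex_less f xs []" "word_colex_less f [] ys \<longleftrightarrow> ys \<noteq> []"
  by (auto simp: word_colex_less_def)

lemma set_encode_less_power:
  assumes "\<And>a. a \<in> A \<Longrightarrow> a < m" shows "set_encode A < 2 ^ m"
proof -
  have "A \<subseteq> {..<m}" using assms by auto
  then have "set_encode A \<le> set_encode {..<m}"
    unfolding set_encode_def by (rule sum_mono2[rotated]) auto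
  also have "\<dots> < 2 ^ m"
    by (induction m) (auto simp: lessThan_Suc)
  finally show ?thesis .
qed

text \<open>The last letter of a sorted word carries the leading binary digit, whose weight exceeds
  the sum of all lower ones. Different last letters thus decide both comparisons, and equal ones
  contribute the same power to both codes.\<close>

lemma word_colex_less_iff_set_encode:
  assumes "sorted_wrt (<) (map f xs)" "sorted_wrt (<) (map f ys)"
    "inj_on f (set xs \<union> set ys)"
  shows "word_colex_less f xs ys \<longleftrightarrow> set_encode (f ` set xs) < set_encode (f ` set ys)"
  using assms
proof (induction xs arbitrary: ys rule: rev_induct)
  case Nil
  show ?case
  proof (cases "ys = []")
    case False
    then have "set_encode (f ` set ys) \<noteq> set_encode {}"
      by (subst set_encode_eq) auto
    then show ?thesis using False by (simp add: word_colex_less_Nil)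
  qed (simp add: word_colex_less_Nil)
next
  case (snoc x xs)
  have below: "set_encode (f ` set (zs @ [z])) = 2 ^ f z + set_encode (f ` set zs)"
    "set_encode (f ` set zs) < 2 ^ f z"
    if "sorted_wrt (<) (map f (zs @ [z]))" for zs z
  proof -
    have lt: "\<And>a. a \<in> f ` set zs \<Longrightarrow> a < f z"
      using that by (auto simp: sorted_wrt_append)
    then show "set_encode (f ` set zs) < 2 ^ f z" by (rule set_encode_less_power)
    have "f z \<notin> f ` set zs" using lt by blast
    then show "set_encode (f ` set (zs @ [z])) = 2 ^ f z + set_encode (f ` set zs)"
      by simp
  qed
  show ?case
  proof (cases ys rule: rev_cases)
    case Nil
    then show ?thesis by (simp add: word_colex_less_Nil)
  next
    case ys: (snoc ys' y)
    note bx = below[OF snoc.prems(1)] and by' = below[OF snoc.prems(2)[unfolded ys]]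
    have mono: "2 ^ Suc a \<le> (2::nat) ^ b" if "a < b" for a b :: nat
      using that by (intro power_increasing) auto
    consider "x = y" | "x \<noteq> y" "f x < f y" | "x \<noteq> y" "f y < f x"
      using snoc.prems(3) ys by (metis Un_iff in_set_conv_decomp inj_on_def nat_neq_iff)
    then show ?thesis
    proof cases
      case 1
      have "inj_on f (set xs \<union> set ys')"
        using snoc.prems(3) by (rule inj_on_subset) (auto simp: ys)
      then have "word_colex_less f xs ys' \<longleftrightarrow>
          set_encode (f ` set xs) < set_encode (f ` set ys')"
        using snoc.IH snoc.prems ys by (simp add: sorted_wrt_append)
      then show ?thesis unfolding ys bx(1) by'(1) word_colex_less_snoc using 1 by simp
    next
      case 2
      then show ?thesis unfolding ys bx(1) by'(1) word_colex_less_snoc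
        using bx(2) mono[of "f x" "f y"] by simp
    next
      case 3
      then show ?thesis unfolding ys bx(1) by'(1) word_colex_less_snoc
        using by'(2) mono[of "f y" "f x"] by simp
    qed
  qed
qed

lemma colex_less_iff_set_encode:
  assumes "inj_on f V" "finite V" "\<sigma> \<subseteq> V" "\<tau> \<subseteq> V"
  shows "colex_less f \<sigma> \<tau> \<longleftrightarrow> set_encode (f ` \<sigma>) < set_encode (f ` \<tau>)"
proof -
  \<comment> \<open>The locale supplies the facts on \<open>sorted_key_list_of_set\<close> for a key
    injective on \<open>V\<close> only; the rewrite identifies its constant with the one in
    \<open>vertex_word\<close>.\<close>
  interpret folding_insort_key "(\<le>)" "(<)" V f
    rewrites "linorder.sorted_key_list_of_set (\<le>) = sorted_key_list_of_set"
    by (unfold_locales, rule assms(1)) (simp only: linorder_class.sorted_key_list_of_set_dict)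
  have "finite \<sigma>" "finite \<tau>" using assms finite_subset by auto
  moreover have "inj_on f (\<sigma> \<union> \<tau>)"
    using assms by (meson inj_on_subset Un_least)
  ultimately show ?thesis
    unfolding colex_less_def vertex_word_def
    using word_colex_less_iff_set_encode[OF strict_sorted_key_list_of_set[OF assms(3)]
        strict_sorted_key_list_of_set[OF assms(4)]] assms
    by (simp only: set_sorted_key_list_of_set)
qed

text \<open>Distinct simplices have distinct codes, so \<open>K\<close> sorted by code is the one
  list that fits the description in \<open>colex_filtration\<close>; this makes the
  \<open>THE\<close> well defined.\<close>

lemma colex_filtration_properties:
  assumes inj: "inj_on f V" and V: "finite V" and K: "K \<subseteq> Pow V"
  shows "distinct (colex_filtration f K)" "set (colex_filtration f K) = K"
    "sorted_wrt (colex_less f) (colex_filtration f K)"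
proof -
  define code where "code \<sigma> = set_encode (f ` \<sigma>)" for \<sigma>
  have "finite K" using V K by (meson finite_Pow_iff finite_subset)
  have "inj_on code K"
  proof (rule inj_onI)
    fix \<sigma> \<tau> assume *: "\<sigma> \<in> K" "\<tau> \<in> K" "code \<sigma> = code \<tau>"
    then have sub: "\<sigma> \<subseteq> V" "\<tau> \<subseteq> V" using K by auto
    then have "finite \<sigma>" "finite \<tau>" using V finite_subset by auto
    then have "f ` \<sigma> = f ` \<tau>"
      using * by (simp add: code_def set_encode_eq)
    then show "\<sigma> = \<tau>" using inj sub by (simp add: inj_on_image_eq_iff)
  qed
  then interpret folding_insort_key "(\<le>)" "(<)" K code
    rewrites "linorder.sorted_key_list_of_set (\<le>) = sorted_key_list_of_set"
    by (unfold_locales, assumption) (simp only: linorder_class.sorted_key_list_of_set_dict)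
  let ?L = "sorted_key_list_of_set code K"
  have less_iff: "colex_less f \<sigma> \<tau> \<longleftrightarrow> code \<sigma> < code \<tau>" if "\<sigma> \<in> K" "\<tau> \<in> K" for \<sigma> \<tau>
    using that K colex_less_iff_set_encode[OF inj V] unfolding code_def by blast
  have sorted_iff: "sorted_wrt (colex_less f) l \<longleftrightarrow> sorted_wrt (<) (map code l)" if "set l = K" for l
    unfolding sorted_wrt_map
    by (rule iffI; rule sorted_wrt_mono_rel[rotated], assumption) (simp_all add: that less_iff)
  have "distinct \<sigma>s \<and> set \<sigma>s = K \<and> sorted_wrt (colex_less f) \<sigma>s \<longleftrightarrow> \<sigma>s = ?L" for \<sigma>s
    using sorted_key_list_of_set_unique[of K \<sigma>s] \<open>finite K\<close> sorted_iff[of \<sigma>s]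
    by (auto simp: distinct_card distinct_if_distinct_map)
  then have "colex_filtration f K = ?L"
    and "distinct ?L \<and> set ?L = K \<and> sorted_wrt (colex_less f) ?L"
    by (simp_all add: colex_filtration_def)
  then show "distinct (colex_filtration f K)" "set (colex_filtration f K) = K"
    "sorted_wrt (colex_less f) (colex_filtration f K)"
    by simp_all
qed

text \<open>All elements of \<open>A\<close> exceed \<open>m\<close>, so its code is a multiple of
  \<open>2 ^ m\<close> and the code of \<open>B\<close> lies in the same block of length
  \<open>2 ^ m\<close>. Hence the two sets agree from \<open>m\<close> upward, and being different
  they differ below \<open>m\<close>, where \<open>A\<close> has no elements.\<close>

lemma set_encode_between_superset:
  assumes fin: "finite A" "finite B" and above: "\<And>a. a \<in> A \<Longrightarrow> m < a"
    and lower: "set_encode A < set_encode B" and upper: "set_encode B < 2 ^ m + set_encode A"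
  shows "A \<subseteq> B" "\<exists>b\<in>B - A. b < m"
proof -
  have "2 ^ m dvd set_encode A"
    unfolding set_encode_def using above by (intro dvd_sum) (auto intro!: le_imp_power_dvd less_imp_le)
  then obtain q where q: "set_encode A = 2 ^ m * q" by (elim dvdE)
  have "set_encode B div 2 ^ m = q"
    using lower upper q by (intro div_nat_eqI) (auto simp: algebra_simps)
  then have div_eq: "set_encode B div 2 ^ m = set_encode A div 2 ^ m"
    using q by simp
  have mem: "a \<in> S \<longleftrightarrow> odd (set_encode S div 2 ^ m div 2 ^ (a - m))" if "finite S" "m \<le> a" for a S
  proof -
    have "a \<in> S \<longleftrightarrow> a \<in> set_decode (set_encode S)" using that by simp
    also have "\<dots> \<longleftrightarrow> odd (set_encode S div 2 ^ a)" by (simp add: set_decode_def)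
    also have "(2::nat) ^ a = 2 ^ m * 2 ^ (a - m)"
      using that by (simp flip: power_add)
    finally show ?thesis by (simp add: div_mult2_eq)
  qed
  have agree: "a \<in> B \<longleftrightarrow> a \<in> A" if "m \<le> a" for a
    using mem[OF _ that] fin div_eq by metis
  show "A \<subseteq> B" using agree above by (meson less_imp_le subsetI)
  have "B \<noteq> A" using lower by auto
  then show "\<exists>b\<in>B - A. b < m"
    using agree \<open>A \<subseteq> B\<close> by (metis DiffI not_le subsetI subset_antisym)
qed

section \<open>Arrows of the colex vector field\<close>

theorem proposition3p4:
  fixes V :: "'a set" and K :: "'a set set" and f :: "'a \<Rightarrow> nat" and n :: nat
    and \<alpha> \<beta> :: "'a set"
  assumes "finite V" and "card V = n"
    and "simplicial_complex V K" and "finite K"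
    and "bij_betw f V {1..n}"
    and "(\<alpha>, \<beta>) \<in> colex_vector_field V K f"
  shows
    "(\<forall>v\<in>\<alpha>. f (candidate_vertex V K f \<alpha>) < f v \<and>
        (f (candidate_vertex V K f \<alpha>) < f v \<longleftrightarrow>
           word_colex_less f [candidate_vertex V K f \<alpha>] [v])) \<and>
     f (candidate_vertex V K f \<alpha>) < appearance f \<alpha> \<and>
     simplex_value f \<alpha> = simplex_value f \<beta> \<and>
     (\<forall>\<tau>. codim1_face \<tau> \<beta> \<and> appearance f \<tau> > appearance f \<beta> \<longleftrightarrow> \<tau> = \<alpha>) \<and>
     (colex_less f \<alpha> \<beta> \<and> \<not> (\<exists>\<gamma>\<in>K. colex_less f \<alpha> \<gamma> \<and> colex_less f \<gamma> \<beta>)) \<and>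
     (\<alpha>, \<beta>) \<in> persistence_pairs (colex_filtration f K)"
proof -
  define c where "c = candidate_vertex V K f \<alpha>"
  define L where "L = colex_filtration f K"
  have inj: "inj_on f V" using assms(5) by (rule bij_betw_imp_inj_on)
  have \<alpha>K: "\<alpha> \<in> K" and \<beta>K: "\<beta> \<in> K" and \<beta>: "\<beta> = insert c \<alpha>" and c\<alpha>: "c \<notin> \<alpha>"
    using assms(6) by (auto simp: colex_vector_field_def c_def)
  have simplex: "\<sigma> \<noteq> {}" "finite \<sigma>" "\<sigma> \<subseteq> V" if "\<sigma> \<in> K" for \<sigma>
    using assms(3) that by (auto simp: simplicial_complex_def)
  have face: "\<tau> \<in> K" if "\<sigma> \<in> K" "\<tau> \<subseteq> \<sigma>" "\<tau> \<noteq> {}" for \<sigma> \<tau>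
    using assms(3) that unfolding simplicial_complex_def by blast
  have c_least: "f c \<le> f v" if "{v} \<union> \<alpha> \<in> K" for v
  proof -
    have "v \<in> candidate_list V K \<alpha>"
      using that simplex(3)[OF that] by (auto simp: candidate_list_def)
    moreover have "finite (candidate_list V K \<alpha>)"
      using assms(1) by (simp add: candidate_list_def)
    ultimately show ?thesis
      unfolding c_def candidate_vertex_def by (intro arg_min_least) auto
  qed
  \<comment> \<open>A vertex of \<alpha> is itself a candidate, because adding it leaves \<alpha>
    unchanged; strictness comes from \<open>c \<notin> \<alpha>\<close> and injectivity.\<close>
  have c_less: "f c < f v" if "v \<in> \<alpha>" for v
  proof -
    have "f c \<le> f v"
      using that \<alpha>K by (intro c_least) (simp add: insert_absorb)
    moreover have "f c \<noteq> f v"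
      using inj simplex(3)[OF \<beta>K] that c\<alpha> by (auto simp: \<beta> inj_on_def)
    ultimately show ?thesis by simp
  qed
  have a: "\<forall>v\<in>\<alpha>. f c < f v \<and> (f c < f v \<longleftrightarrow> word_colex_less f [c] [v])"
    using c_less c\<alpha> word_colex_less_snoc[of f "[]" c "[]"] by auto
  have b: "f c < appearance f \<alpha>"
    using c_less simplex[OF \<alpha>K] by (simp add: appearance_def)
  have app_\<beta>: "appearance f \<beta> = f c"
    unfolding appearance_def using c_less simplex[OF \<alpha>K]
    by (intro Min_eqI) (auto simp: \<beta> less_imp_le)
  have "f c \<le> Max (f ` \<alpha>)"
    using c_less simplex[OF \<alpha>K] by (auto simp: Max_ge_iff less_imp_le)
  then have c': "simplex_value f \<alpha> = simplex_value f \<beta>"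
    using simplex[OF \<alpha>K] by (simp add: simplex_value_def \<beta> max_absorb2)
  have face_\<alpha>\<beta>: "codim1_face \<alpha> \<beta>"
    using c\<alpha> simplex[OF \<alpha>K] by (auto simp: codim1_face_def \<beta>)
  have d: "codim1_face \<tau> \<beta> \<and> appearance f \<tau> > appearance f \<beta> \<longleftrightarrow> \<tau> = \<alpha>" for \<tau>
  proof
    assume *: "codim1_face \<tau> \<beta> \<and> appearance f \<tau> > appearance f \<beta>"
    then have \<tau>: "\<tau> \<subseteq> \<beta>" "card \<tau> = card \<alpha>"
      using face_\<alpha>\<beta> by (auto simp: codim1_face_def)
    have "finite \<tau>" using \<tau> simplex(2)[OF \<beta>K] finite_subset by blast
    \<comment> \<open>A face with larger appearance value must omit \<open>c\<close>, so it lies in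
      \<alpha> and has the same cardinality.\<close>
    have "c \<notin> \<tau>"
    proof
      assume "c \<in> \<tau>"
      then have "appearance f \<tau> \<le> f c" using \<open>finite \<tau>\<close> by (simp add: appearance_def)
      then show False using * app_\<beta> by simp
    qed
    then have "\<tau> \<subseteq> \<alpha>" using \<tau> by (auto simp: \<beta>)
    then show "\<tau> = \<alpha>" using \<tau> simplex(2)[OF \<alpha>K] card_subset_eq by blast
  qed (use face_\<alpha>\<beta> b app_\<beta> in simp)
  have less_iff: "colex_less f \<sigma> \<tau> \<longleftrightarrow> set_encode (f ` \<sigma>) < set_encode (f ` \<tau>)"
    if "\<sigma> \<in> K" "\<tau> \<in> K" for \<sigma> \<tau>
    using colex_less_iff_set_encode[OF inj assms(1)] simplex that by blast
  have code_\<beta>: "set_encode (f ` \<beta>) = 2 ^ f c + set_encode (f ` \<alpha>)"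
    unfolding \<beta> image_insert using c_less simplex(2)[OF \<alpha>K]
    by (intro set_encode_insert) (fastforce dest: c_less)+
  have less_\<alpha>\<beta>: "colex_less f \<alpha> \<beta>"
    using less_iff[OF \<alpha>K \<beta>K] code_\<beta> by simp
  have adjacent: False if \<gamma>: "\<gamma> \<in> K" "colex_less f \<alpha> \<gamma>" "colex_less f \<gamma> \<beta>" for \<gamma>
  proof -
    have fin: "finite (f ` \<alpha>)" "finite (f ` \<gamma>)"
      using simplex(2)[OF \<alpha>K] simplex(2)[OF \<gamma>(1)] by simp_all
    have above: "\<And>a. a \<in> f ` \<alpha> \<Longrightarrow> f c < a" using c_less by blast
    have codes: "set_encode (f ` \<alpha>) < set_encode (f ` \<gamma>)"
      "set_encode (f ` \<gamma>) < 2 ^ f c + set_encode (f ` \<alpha>)"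
      using \<gamma> less_iff[OF \<alpha>K \<gamma>(1)] less_iff[OF \<gamma>(1) \<beta>K] code_\<beta> by simp_all
    note * = set_encode_between_superset[OF fin above codes]
    have "\<alpha> \<subseteq> \<gamma>"
      using *(1) simplex(3)[OF \<alpha>K] inj_on_image_mem_iff[OF inj _ simplex(3)[OF \<gamma>(1)]] by blast
    moreover obtain v where v: "v \<in> \<gamma>" "f v < f c" using * by blast
    \<comment> \<open>This is a face of \<gamma>, hence in \<open>K\<close>, so \<open>v\<close> is
      a candidate of smaller value than \<open>c\<close>.\<close>
    ultimately have "{v} \<union> \<alpha> \<in> K" by (intro face[OF \<gamma>(1)]) auto
    then show False using c_least v by fastforce
  qed
  have "K \<subseteq> Pow V" using simplex by blast
  note L = colex_filtration_properties[OF inj assms(1) this, folded L_def]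
  have nth_less: "colex_less f (L ! i) (L ! k)" if "i < k" "k < length L" for i k
    using L(3) that by (simp add: sorted_wrt_iff_nth_less)
  have nthK: "L ! i \<in> K" if "i < length L" for i
    using that L(2) nth_mem by blast
  \<comment> \<open>On \<open>K\<close> the order compares codes and so is asymmetric; comparisons
    of simplices thereby become comparisons of positions.\<close>
  have index_less: "i < k"
    if "i < length L" "k < length L" "colex_less f (L ! i) (L ! k)" for i k
  proof (rule ccontr)
    assume "\<not> i < k"
    then have "k < i \<or> k = i" by auto
    then show False
      using that nth_less[of k i] less_iff nthK by fastforce
  qed
  obtain i where i: "i < length L" "L ! i = \<alpha>" using L(2) \<alpha>K by (metis in_set_conv_nth)
  obtain j where j: "j < length L" "L ! j = \<beta>" using L(2) \<beta>K by (metis in_set_conv_nth)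
  have "i < j" using index_less i j less_\<alpha>\<beta> by blast
  have "j = Suc i"
  proof (rule ccontr)
    assume "j \<noteq> Suc i"
    then have "Suc i < j" using \<open>i < j\<close> by simp
    then show False
      using adjacent[of "L ! Suc i"] nthK[of "Suc i"] nth_less[of i "Suc i"] nth_less[of "Suc i" j] i j
      by auto
  qed
  \<comment> \<open>A proper face has a proper subset of the digits, hence a smaller code: faces
    precede cofaces, as the reduction argument requires.\<close>
  have order: "k < l" if kl: "k < length L" "l < length L" "codim1_face (L ! k) (L ! l)" for k l
  proof -
    have "L ! k \<subset> L ! l" using kl(3) by (auto simp: codim1_face_def)
    then have "f ` (L ! k) \<subset> f ` (L ! l)"
      by (rule image_strict_mono[OF inj_on_subset[OF inj simplex(3)[OF nthK[OF kl(2)]]]])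
    then have "set_encode (f ` (L ! k)) < set_encode (f ` (L ! l))"
      using simplex(2)[OF nthK[OF kl(1)]] simplex(2)[OF nthK[OF kl(2)]]
      by (simp add: order_less_le set_encode_eq subset_decode_imp_le)
    then show ?thesis using index_less[OF kl(1,2)] less_iff[OF nthK[OF kl(1)] nthK[OF kl(2)]] by simp
  qed
  have "Suc i < length L" "codim1_face (L ! i) (L ! Suc i)"
    using i j \<open>j = Suc i\<close> face_\<alpha>\<beta> by simp_all
  from consecutive_persistence_pair[OF this order] have pair: "(\<alpha>, \<beta>) \<in> persistence_pairs L"
    using i j \<open>j = Suc i\<close> by simp
  show ?thesis
    unfolding c_def[symmetric] L_def[symmetric]
    by (intro conjI a b c' less_\<alpha>\<beta> pair allI d notI) (use adjacent in blast)
qed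

end
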